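(* Let $k,n,\ell$ be integers with $2\leq \ell\leq n-3$ and $2\leq k\leq n$. If $n$ and $\ell$ have different parity, then $$n-1\leq t(n,k,\ell)\leq n-1+\frac{n-\ell-1}{2}.$$ If $n$ and $\ell$ have the same parity, then $$n-1\leq t(n,k,\ell)\leq n-1+\frac{n-\ell}{2}.$$
   Context: All graphs are finite, simple and undirected. For a graph $G=(V,E)$ and $S\subseteq V$ with $|S|\ge 2$, an $S$-tree is a subgraph $T$ of $G$ that is a tree with $S\subseteq V(T)$. Given a vertex-coloring $c$ of $G$ (not necessarily proper), an $S$-tree $T$ is a vertex-rainbow $S$-tree if the vertices of $V(T)\setminus S$ receive pairwise distinct colors. For $2\le k\le n=|V(G)|$, a vertex-coloring is a $k$-vertex-rainbow coloring if for every $k$-subset $S\subseteq V(G)$ there is a vertex-rainbow $S$-tree. The $k$-vertex-rainbow index $rvx_k(G)$ of a connected graph $G$ is the minimum number of colors in a $k$-vertex-rainbow coloring of $G$ (with $rvx_k(G)=0$ meaning every $k$-subset $S$ has an $S$-tree with vertex set exactly $S$). For $2\le \ell\le n-2$ and $2\le k\le n$, $t(n,k,\ell)$ denotes the minimum number of edges of a connected graph $G$ of order $n$ with $rvx_k(G)\le \ell$. *)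

theory Defs
  imports Complex_Main "Graph_Theory.Digraph_Component"
begin

text \<open>
  Finite simple undirected graphs are the symmetric loop-free finite digraphs without parallel
  arcs (locale \<^locale>\<open>pair_graph\<close>): an undirected edge is a pair of opposite arcs.
\<close>

definition uedges :: "'a pair_pre_digraph \<Rightarrow> 'a set set" where
  "uedges G = (\<lambda>(u, v). {u, v}) ` parcs G"

text \<open>
  The library's \<^const>\<open>Digraph_Component.tree\<close> forbids all directed cycles, hence also the closed
  walk u, v, u along a single undirected edge. A cycle of a simple undirected graph is a directed
  cycle of length at least 3, so only those are forbidden here.
\<close>

definition utree :: "'a pair_pre_digraph \<Rightarrow> bool" where
  "utree T \<longleftrightarrow> pair_graph T \<and> Digraph_Component.connected (with_proj T) \<and>
     \<not> (\<exists>p. pre_digraph.cycle (with_proj T) p \<and> 3 \<le> length p)"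

definition S_tree :: "'a pair_pre_digraph \<Rightarrow> 'a set \<Rightarrow> 'a pair_pre_digraph \<Rightarrow> bool" where
  "S_tree G S T \<longleftrightarrow> subgraph (with_proj T) (with_proj G) \<and> utree T \<and> S \<subseteq> pverts T"

definition vertex_rainbow_S_tree ::
  "'a pair_pre_digraph \<Rightarrow> ('a \<Rightarrow> nat) \<Rightarrow> 'a set \<Rightarrow> 'a pair_pre_digraph \<Rightarrow> bool" where
  "vertex_rainbow_S_tree G c S T \<longleftrightarrow> S_tree G S T \<and> inj_on c (pverts T - S)"

definition k_vertex_rainbow_coloring :: "nat \<Rightarrow> 'a pair_pre_digraph \<Rightarrow> ('a \<Rightarrow> nat) \<Rightarrow> bool" where
  "k_vertex_rainbow_coloring k G c \<longleftrightarrow>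
     (\<forall>S. S \<subseteq> pverts G \<and> card S = k \<longrightarrow> (\<exists>T. vertex_rainbow_S_tree G c S T))"

text \<open>
  The number of colors of a coloring is the number of colors that occur, which is at least 1 on a
  nonempty graph; the value 0 is therefore a separate convention. For connected graphs the
  minimum exists, since a coloring with pairwise distinct colors is k-vertex-rainbow.
\<close>

definition rvx :: "nat \<Rightarrow> 'a pair_pre_digraph \<Rightarrow> nat" where
  "rvx k G =
     (if \<forall>S. S \<subseteq> pverts G \<and> card S = k \<longrightarrow> (\<exists>T. S_tree G S T \<and> pverts T = S) then 0
      else LEAST r. \<exists>c. k_vertex_rainbow_coloring k G c \<and> card (c ` pverts G) = r)"

text \<open>
  Every finite graph is isomorphic to one whose vertices are natural numbers, so the minimum is
  taken over those. Complete graphs (where \<^const>\<open>rvx\<close> is 0) show that it exists.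
\<close>

definition t_min :: "nat \<Rightarrow> nat \<Rightarrow> nat \<Rightarrow> nat" where
  "t_min n k l =
     (LEAST m. \<exists>G :: nat pair_pre_digraph. pair_graph G \<and> Digraph_Component.connected (with_proj G) \<and>
        card (pverts G) = n \<and> rvx k G \<le> l \<and> card (uedges G) = m)"

end

theory Submission
  imports Defs
begin

text \<open>
  The star gives t(n, k, l) = n - 1 for every l > 0: every vertex set S lies in the substar
  spanned by S and the center, which has at most one vertex outside S, so a single color suffices.
  Conversely, in a connected graph each vertex other than a root r owns the edge to a neighbor
  closer to r, and distinct vertices own distinct edges.
\<close>

lemma finite_uedges:
  assumes "pair_graph G"
  shows "finite (uedges G)"
proof -
  interpret pair_graph G by fact
  show ?thesis
    by (simp add: uedges_def pair_finite_arcs)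
qed

lemma connected_card_verts_le:
  assumes "pair_graph G" and conn: "Digraph_Component.connected (with_proj G)"
  shows "card (pverts G) \<le> Suc (card (uedges G))"
proof -
  interpret pair_graph G by fact
  from conn obtain r where r: "r \<in> pverts G"
    by (auto simp: connected_def strongly_connected_def)
  have "\<exists>m. (r, v) \<in> parcs G ^^ m" if "v \<in> pverts G" for v
  proof -
    \<comment> \<open>\<open>connected\<close> speaks of reachability in the symmetric closure; as
      \<open>G\<close> is symmetric, this is reachability in \<open>G\<close> itself.\<close>
    have "r \<rightarrow>\<^sup>*\<^bsub>with_proj (mk_symmetric (with_proj G))\<^esub> v"
      using conn r that by (auto simp: connected_def strongly_connected_def)
    then have "r \<rightarrow>\<^sup>*\<^bsub>with_proj G\<^esub> v"
      using reachable_mk_symmetric_eq[OF pair_sym_arcs] by simp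
    from reachable_rtranclI[OF this] have "(r, v) \<in> (parcs G)\<^sup>*" by simp
    then show ?thesis by (rule rtrancl_imp_relpow)
  qed
  note reach = this
  \<comment> \<open>The distance from \<open>r\<close>; cutting the last arc off a shortest walk to
    \<open>v\<close> yields a neighbor closer to \<open>r\<close>.\<close>
  define d where "d v = (LEAST m. (r, v) \<in> parcs G ^^ m)" for v
  have "\<exists>u. (u, v) \<in> parcs G \<and> d u < d v" if v: "v \<in> pverts G - {r}" for v
  proof -
    have dv: "(r, v) \<in> parcs G ^^ d v"
      unfolding d_def using reach v by (auto intro: LeastI_ex)
    \<comment> \<open>Distance 0 would force \<open>v = r\<close>.\<close>
    with v obtain m where m: "d v = Suc m" by (cases "d v") auto
    with dv obtain u where u: "(r, u) \<in> parcs G ^^ m" "(u, v) \<in> parcs G" by auto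
    from u(1) have "d u \<le> m" unfolding d_def by (rule Least_le)
    with u m show ?thesis by auto
  qed
  then obtain p where p: "\<And>v. v \<in> pverts G - {r} \<Longrightarrow> (p v, v) \<in> parcs G \<and> d (p v) < d v"
    by metis
  have "inj_on (\<lambda>v. {p v, v}) (pverts G - {r})"
  proof (rule inj_onI)
    fix v w
    assume "v \<in> pverts G - {r}" "w \<in> pverts G - {r}" "{p v, v} = {p w, w}"
    \<comment> \<open>If \<open>v\<close> and \<open>w\<close> differed, then \<open>p v = w\<close>
      and \<open>p w = v\<close>, so \<open>d w < d v < d w\<close>.\<close>
    with p[of v] p[of w] show "v = w" by (auto simp: doubleton_eq_iff)
  qed
  moreover have "(\<lambda>v. {p v, v}) ` (pverts G - {r}) \<subseteq> uedges G"
    using p by (force simp: uedges_def)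
  ultimately have "card (pverts G - {r}) \<le> card (uedges G)"
    using finite_uedges[OF assms(1)] by (rule card_inj_on_le)
  with r show ?thesis
    by (simp add: pair_finite_verts card_Diff_singleton)
qed

text \<open>Inserting \<open>z\<close> into the vertices and removing it from the leaves lets
  \<open>A\<close> contain the center or not, so \<open>star z S\<close> makes sense for every
  \<open>S\<close> without creating a loop.\<close>

definition star :: "'a \<Rightarrow> 'a set \<Rightarrow> 'a pair_pre_digraph" where
  "star z A = \<lparr>pverts = insert z A, parcs = {z} \<times> (A - {z}) \<union> (A - {z}) \<times> {z}\<rparr>"

lemma star_simps [simp]:
  "pverts (star z A) = insert z A"
  "parcs (star z A) = {z} \<times> (A - {z}) \<union> (A - {z}) \<times> {z}"
  by (simp_all add: star_def)

lemma pair_graph_star: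
  assumes "finite A"
  shows "pair_graph (star z A)"
  using assms by unfold_locales (auto simp: symmetric_def intro: symI)

lemma connected_star:
  assumes "finite A"
  shows "Digraph_Component.connected (with_proj (star z A))"
proof -
  interpret pair_graph "star z A" using assms by (rule pair_graph_star)
  have adj: "z \<rightarrow>\<^sup>*\<^bsub>with_proj (star z A)\<^esub> v \<and> v \<rightarrow>\<^sup>*\<^bsub>with_proj (star z A)\<^esub> z" if "v \<in> insert z A" for v
    using that by (cases "v = z") (auto intro!: reachable_adjI)
  show ?thesis
    unfolding connected_def
  proof (rule strongly_connectedI)
    fix u v
    assume "u \<in> verts (with_proj (mk_symmetric (with_proj (star z A))))"
      and "v \<in> verts (with_proj (mk_symmetric (with_proj (star z A))))"
    then have "u \<rightarrow>\<^sup>*\<^bsub>with_proj (star z A)\<^esub> v"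
      using adj by (auto intro: reachable_trans)
    then show "u \<rightarrow>\<^sup>*\<^bsub>with_proj (mk_symmetric (with_proj (star z A)))\<^esub> v"
      by (rule reachable_mk_symmetricI)
  qed simp
qed

text \<open>
  Along a walk in a star every second vertex is the center, so a closed walk of length at least 3
  has length at least 4 and visits the center twice.
\<close>

lemma utree_star:
  assumes "finite A"
  shows "utree (star z A)"
proof -
  interpret pair_graph "star z A" using assms by (rule pair_graph_star)
  have False if cyc: "cycle p" and len: "3 \<le> length p" for p
  proof -
    from len obtain e1 e2 e3 es where p: "p = e1 # e2 # e3 # es"
      by (metis Suc_le_length_iff numeral_3_eq_3)
    from cyc obtain u where walk: "pcas u p u" and arcs: "set p \<subseteq> parcs (star z A)"
      and dist: "distinct (tl (pawalk_verts u p))"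
      by (auto simp: cycle_def awalk_def)
    have alt: "fst e = z \<longleftrightarrow> snd e \<noteq> z" if "e \<in> set p" for e
      using arcs that by auto
    have alts: "fst e1 = z \<longleftrightarrow> snd e1 \<noteq> z" "fst e2 = z \<longleftrightarrow> snd e2 \<noteq> z"
      "fst e3 = z \<longleftrightarrow> snd e3 \<noteq> z"
      by (rule alt, simp add: p)+
    have links: "fst e1 = u" "fst e2 = snd e1" "fst e3 = snd e2"
      using walk by (simp_all add: p)
    show False
    proof (cases es)
      case Nil
      then have "snd e3 = u" using walk by (simp add: p)
      \<comment> \<open>Three alternations between center and leaf lead from \<open>u\<close> to a
        vertex of the other kind, not back to \<open>u\<close>.\<close>
      with alts links show False by metis
    next
      case (Cons e4 es')
      then have e4: "fst e4 = snd e3" "fst e4 = z \<longleftrightarrow> snd e4 \<noteq> z" "pcas (snd e4) es' u"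
        using walk alt[of e4] by (simp_all add: p)
      from e4(3) have "snd e4 \<in> set (pawalk_verts (snd e4) es')" by (cases es') simp_all
      \<comment> \<open>Either \<open>fst e2\<close> and \<open>fst e4\<close> are both the center,
        or \<open>fst e3\<close> and \<open>snd e4\<close> are; distinctness excludes both.\<close>
      moreover have "fst e2 \<noteq> fst e4" "fst e3 \<notin> set (pawalk_verts (snd e4) es')"
        using dist by (simp_all add: p Cons)
      ultimately show False using alts links e4(1,2) by metis
    qed
  qed
  with pair_graph_axioms connected_star[OF assms] show ?thesis
    unfolding utree_def by metis
qed

lemma uedges_star: "uedges (star z A) = (\<lambda>v. {z, v}) ` (A - {z})"
  by (force simp: uedges_def)

lemma card_uedges_star: "card (uedges (star z A)) = card (A - {z})"
  unfolding uedges_star by (rule card_image) (auto simp: inj_on_def doubleton_eq_iff)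

text \<open>Every leaf of \<open>star z S\<close> is a leaf of \<open>star z A\<close>, so its arcs
  are inherited. Only \<open>z\<close> can be a vertex of this tree outside
  \<open>S\<close>.\<close>

lemma S_tree_star:
  assumes "finite A" and "S \<subseteq> insert z A"
  shows "S_tree (star z A) S (star z S)"
proof -
  have "finite S" using assms finite_subset by auto
  interpret A: pair_graph "star z A" using assms(1) by (rule pair_graph_star)
  interpret S: pair_graph "star z S" using \<open>finite S\<close> by (rule pair_graph_star)
  have "subgraph (with_proj (star z S)) (with_proj (star z A))"
    unfolding subgraph_def using assms(2) A.wf_digraph_axioms S.wf_digraph_axioms
    by (auto simp: compatible_def)
  then show ?thesis
    unfolding S_tree_def using utree_star[OF \<open>finite S\<close>] by auto
qed

lemma rvx_star_le:
  assumes "finite A"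
  shows "rvx k (star z A) \<le> 1"
proof -
  have "vertex_rainbow_S_tree (star z A) (\<lambda>_. 0) S (star z S)" if "S \<subseteq> insert z A" for S
    using S_tree_star[OF assms that] by (auto simp: vertex_rainbow_S_tree_def inj_on_def)
  then have "k_vertex_rainbow_coloring k (star z A) (\<lambda>_. 0)"
    by (auto simp: k_vertex_rainbow_coloring_def)
  moreover have "card ((\<lambda>_. 0 :: nat) ` pverts (star z A)) = 1"
    by (simp add: image_constant_conv)
  ultimately have "(LEAST r. \<exists>c. k_vertex_rainbow_coloring k (star z A) c
      \<and> card (c ` pverts (star z A)) = r) \<le> 1"
    by (intro Least_le) blast
  \<comment> \<open>In the other branch of \<open>rvx_def\<close> the value is 0.\<close>
  then show ?thesis by (auto simp: rvx_def)
qed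

text \<open>The exact value, attained by a star and matched by the edge bound for connected
  graphs.\<close>

lemma t_min_eq:
  assumes "1 \<le> l" and "1 \<le> n"
  shows "t_min n k l = n - 1"
  unfolding t_min_def
proof (rule Least_equality)
  \<comment> \<open>The center 0 lies in \<open>{..<n}\<close> because \<open>1 \<le> n\<close>,
    which leaves exactly \<open>n - 1\<close> leaves.\<close>
  define G :: "nat pair_pre_digraph" where "G = star 0 {..<n}"
  have "pair_graph G" "Digraph_Component.connected (with_proj G)" "card (pverts G) = n"
    "rvx k G \<le> l" "card (uedges G) = n - 1"
    using assms rvx_star_le[of "{..<n}" k "0 :: nat"]
    by (simp_all add: G_def pair_graph_star connected_star card_uedges_star insert_absorb)
  then show "\<exists>G :: nat pair_pre_digraph. pair_graph G \<and>
      Digraph_Component.connected (with_proj G) \<and>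
      card (pverts G) = n \<and> rvx k G \<le> l \<and> card (uedges G) = n - 1"
    by blast
next
  fix m
  assume "\<exists>G :: nat pair_pre_digraph. pair_graph G \<and>
      Digraph_Component.connected (with_proj G) \<and>
      card (pverts G) = n \<and> rvx k G \<le> l \<and> card (uedges G) = m"
  then show "n - 1 \<le> m"
    by (auto dest: connected_card_verts_le)
qed

theorem theorem1p3:
  fixes k n l :: nat
  assumes "2 \<le> l" and "l + 3 \<le> n"
    and "2 \<le> k" and "k \<le> n"
  shows "(even n \<noteq> even l \<longrightarrow>
           real n - 1 \<le> real (t_min n k l) \<and>
           real (t_min n k l) \<le> real n - 1 + (real n - real l - 1) / 2) \<and>
         (even n = even l \<longrightarrow>
           real n - 1 \<le> real (t_min n k l) \<and>
           real (t_min n k l) \<le> real n - 1 + (real n - real l) / 2)"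
  \<comment> \<open>The lower bounds hold with equality, and the fractions in the upper bounds are
    nonnegative because \<open>l + 3 \<le> n\<close>.\<close>
  using assms by (simp add: t_min_eq of_nat_diff)

end
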